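(* For every integer $n\ge 1$, $\log\log e_n \ge n-\log n-1$. Moreover, $\log\log e_n \le n-\log n + O(\log\log n)$ as $n\to\infty$.
   Context: All logarithms $\log$ are to base $2$. A delta-matroid $(E,\mathcal F)$ consists of a finite ground set $E$ and a non-empty collection $\mathcal F$ of subsets of $E$ (the feasible sets) satisfying the symmetric exchange axiom: for all $X,Y\in\mathcal F$ and every $e\in X\triangle Y$ there exists $f\in X\triangle Y$ (possibly $f=e$) with $X\triangle\{e,f\}\in\mathcal F$. A delta-matroid is even if all its feasible sets have cardinalities of the same parity. Let $e_n$ denote the number of labelled even delta-matroids with ground set $[n]=\{1,\dots,n\}$, i.e. the number of collections $\mathcal F$ of subsets of $[n]$ such that $([n],\mathcal F)$ is an even delta-matroid. *)

theory Defs
  imports Complex_Main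
begin

definition sdiff :: "'a set \<Rightarrow> 'a set \<Rightarrow> 'a set" where
  "sdiff X Y = (X - Y) \<union> (Y - X)"

definition delta_matroid :: "'a set \<Rightarrow> 'a set set \<Rightarrow> bool" where
  "delta_matroid E \<F> \<longleftrightarrow> finite E \<and> \<F> \<noteq> {} \<and> (\<forall>X\<in>\<F>. X \<subseteq> E) \<and>
     (\<forall>X\<in>\<F>. \<forall>Y\<in>\<F>. \<forall>e\<in>sdiff X Y. \<exists>f\<in>sdiff X Y. sdiff X {e, f} \<in> \<F>)"

definition even_delta_matroid :: "'a set \<Rightarrow> 'a set set \<Rightarrow> bool" where
  "even_delta_matroid E \<F> \<longleftrightarrow> delta_matroid E \<F> \<and>
     (\<forall>X\<in>\<F>. \<forall>Y\<in>\<F>. even (card X) = even (card Y))"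

definition num_even_dm :: "nat \<Rightarrow> nat" where
  "num_even_dm n = card {\<F>. \<F> \<subseteq> Pow {1..n} \<and> even_delta_matroid {1..n} \<F>}"

end

theory Submission
  imports Defs
begin

text \<open>
  Lower bound: removing a set T from the family of all even subsets leaves an even
  delta-matroid as soon as every odd set has at most two neighbours (sets at distance one) in T.
  Hence T may be any subset of the union of two stable sets: the sets of size 0 mod 4 with a
  prescribed element sum mod n, and those of size 2 mod 4 with another prescribed sum. By
  pigeonhole this union can be chosen with at least 2^(n-1)/n members.

  Upper bound: the infeasible sets K of the right parity, say even, are described by few data.
  For an odd set Z let A Z be the set of g such that flipping g in Z gives an infeasible set. If
  A Z is not the whole ground set, then the exchange axiom makes the whole subcube Z + 2^(A Z)
  infeasible. Flipping e in X in K gives n odd sets Z; call e a loop of X if A Z is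
  everything. For a quarter of the e one of the following holds. (1) e is a loop, or A Z has at
  most twice as many elements as X has loops: all but few of these X are neighbours of a small
  collection of sets Z with A Z everything, by a greedy fractional covering. (2) A Z has size
  O(log n): by double counting there are few such X. (3) A Z is larger than both:
  greedily record subcubes that contain many X not yet recorded; by edge isoperimetry in
  the cube, few X remain.
\<close>

section \<open>The lower bound\<close>

abbreviation flip :: "'a set \<Rightarrow> 'a \<Rightarrow> 'a set" where
  "flip X e \<equiv> sdiff X {e}"

lemma flip_in: "e \<in> X \<Longrightarrow> flip X e = X - {e}"
  and flip_notin: "e \<notin> X \<Longrightarrow> flip X e = insert e X"
  by (auto simp: sdiff_def)

lemma flip_flip [simp]: "flip (flip X e) e = X"
  by (auto simp: sdiff_def)

lemma flip_commute: "flip (flip X e) f = flip (flip X f) e"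
  by (auto simp: sdiff_def)

lemma inj_flip: "flip X e = flip X f \<longleftrightarrow> e = f"
  by (auto simp: sdiff_def)

lemma flip_subset: "X \<subseteq> E \<Longrightarrow> e \<in> E \<Longrightarrow> flip X e \<subseteq> E"
  by (auto simp: sdiff_def)

lemma sdiff_pair: "e \<noteq> f \<Longrightarrow> sdiff X {e, f} = flip (flip X e) f"
  by (auto simp: sdiff_def)

lemma even_card_flip: "finite X \<Longrightarrow> even (card (flip X e)) \<longleftrightarrow> odd (card X)"
  by (cases "e \<in> X") (auto simp: flip_in flip_notin card_Suc_Diff1 card_gt_0_iff)

lemma even_card_sdiff:
  assumes "finite X" "finite Y"
  shows "even (card (sdiff X Y)) \<longleftrightarrow> (even (card X) \<longleftrightarrow> even (card Y))"
proof -
  have split: "card U = card (U - W) + card (U \<inter> W)" if "finite U" for U W :: "'a set"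
    using that card_Un_disjoint[of "U - W" "U \<inter> W"] by (simp add: Un_Diff_Int disjoint_iff)
  have "card X = card (X - Y) + card (X \<inter> Y)" "card Y = card (Y - X) + card (X \<inter> Y)"
    using split[of X Y] split[of Y X] assms by (simp_all add: Int_commute)
  moreover have "card (sdiff X Y) = card (X - Y) + card (Y - X)"
    unfolding sdiff_def using assms by (intro card_Un_disjoint) auto
  ultimately show ?thesis by presburger
qed

lemma card_parity_class:
  assumes "finite E" "E \<noteq> {}"
  shows "2 * card {X. X \<subseteq> E \<and> even (card X) = b} = 2 ^ card E"
proof -
  obtain a where a: "a \<in> E" using assms by auto
  let ?V = "\<lambda>b. {X. X \<subseteq> E \<and> even (card X) = b}"
  have par: "even (card (flip X a)) \<longleftrightarrow> odd (card X)" if "X \<subseteq> E" for X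
    by (rule even_card_flip[OF finite_subset[OF that assms(1)]])
  have "bij_betw (\<lambda>X. flip X a) (?V b) (?V (\<not> b))"
    by (rule bij_betw_byWitness[where f' = "\<lambda>X. flip X a"])
      (use a par flip_subset[of _ E a] in auto)
  then have "card (?V b) = card (?V (\<not> b))" by (rule bij_betw_same_card)
  moreover have "Pow E = ?V b \<union> ?V (\<not> b)" by auto
  then have "card (Pow E) = card (?V b) + card (?V (\<not> b))"
    using assms by (simp add: card_Un_disjoint disjoint_iff)
  ultimately show ?thesis by (simp add: card_Pow assms)
qed

text \<open>If \<open>X\<close> and \<open>Y\<close> differ in two elements, exchange leads to
  \<open>Y\<close> itself. Otherwise parity forces at least four differences, leaving three
  candidates \<open>f\<close> besides \<open>e\<close>; the resulting sets are neighbours of the odd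
  set \<open>flip X e\<close>, and at most two of them lie in \<open>T\<close>.\<close>

lemma even_delta_matroid_sparse_complement:
  assumes "finite E" "card E \<ge> 3"
    and T: "\<And>Z. Z \<subseteq> E \<Longrightarrow> odd (card Z) \<Longrightarrow> card {e \<in> E. flip Z e \<in> T} \<le> 2"
  shows "even_delta_matroid E ({X. X \<subseteq> E \<and> even (card X)} - T)" (is "even_delta_matroid E ?F")
proof -
  have fin: "finite X" if "X \<subseteq> E" for X using that assms(1) finite_subset by blast
  have "?F \<noteq> {}"
  proof -
    obtain a where a: "a \<in> E" using assms by fastforce
    \<comment> \<open>Non-emptiness: the singleton has at least three neighbours, all even, and at
      most two are removed.\<close>
    have "{e \<in> E. flip {a} e \<in> T} \<noteq> E"
      using T[of "{a}"] a assms(2) by auto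
    then obtain e where "e \<in> E" "flip {a} e \<notin> T" by auto
    moreover have "even (card (flip {a} e))" using even_card_flip[of "{a}" e] by simp
    ultimately show ?thesis using a flip_subset[of "{a}" E e] by blast
  qed
  moreover have "\<exists>f\<in>sdiff X Y. sdiff X {e, f} \<in> ?F" if X: "X \<in> ?F" and Y: "Y \<in> ?F" and e: "e \<in> sdiff X Y" for X Y e
  proof -
    let ?D = "sdiff X Y"
    have D: "?D \<subseteq> E" using X Y by (auto simp: sdiff_def)
    have evD: "even (card ?D)" using X Y even_card_sdiff[of X Y] fin by auto
    have eE: "e \<in> E" using D e by blast
    have sub: "sdiff X {e, f} \<subseteq> E" "even (card (sdiff X {e, f}))" if "f \<in> E" "f \<noteq> e" for f
    proof -
      show "sdiff X {e, f} \<subseteq> E" using X eE that by (auto simp: sdiff_def)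
      have "finite X" using X fin by blast
      then show "even (card (sdiff X {e, f}))"
        using X that even_card_sdiff[of X "{e,f}"] by auto
    qed
    have c1: "card (?D - {e}) = card ?D - 1" using e by simp
    have pos: "card ?D > 0" using e fin[OF D] card_gt_0_iff by blast
    show ?thesis
    proof (cases "card ?D = 2")
      case True
      then have "card (?D - {e}) = 1" using c1 by simp
      then obtain f where f: "?D - {e} = {f}" by (rule card_1_singletonE)
      then have Def: "?D = {e, f}" using e by blast
      have "sdiff X {e, f} = Y" unfolding Def[symmetric] by (auto simp: sdiff_def)
      then show ?thesis using Y Def by auto
    next
      case False
      then have "card ?D \<ge> 4" using evD pos by presburger
      then have c3: "card (?D - {e}) \<ge> 3" using c1 by simp
      have "\<exists>f\<in>?D - {e}. sdiff X {e, f} \<notin> T"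
      proof (rule ccontr)
        assume neg: "\<not> ?thesis"
        have "?D - {e} \<subseteq> {f \<in> E. flip (flip X e) f \<in> T}"
        proof
          fix f assume f: "f \<in> ?D - {e}"
          then have "sdiff X {e, f} \<in> T" using neg by blast
          then show "f \<in> {f \<in> E. flip (flip X e) f \<in> T}"
            using f D sdiff_pair[of e f X] by auto
        qed
        then have "card (?D - {e}) \<le> card {f \<in> E. flip (flip X e) f \<in> T}"
          using assms(1) by (intro card_mono) auto
        also have "\<dots> \<le> 2"
          using X eE flip_subset[of X E e] even_card_flip[of X e] fin by (intro T) auto
        finally show False using c3 by simp
      qed
      then show ?thesis using sub D by blast
    qed
  qed
  ultimately show ?thesis
    unfolding even_delta_matroid_def delta_matroid_def using assms(1) by blast
qed

text \<open>A neighbour of \<open>Z\<close> is one larger or one smaller than \<open>Z\<close>; the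
  size mod 4 decides which, and then the sum mod \<open>n\<close> determines the flipped element,
  because \<open>{1..n}\<close> meets each residue class once.\<close>

lemma card_flip_residue_class:
  fixes n :: nat
  assumes "Z \<subseteq> {1..n}"
  shows "card {e \<in> {1..n}. flip Z e \<in> {X. X \<subseteq> {1..n} \<and> card X mod 4 = j \<and> \<Sum>X mod n = c}} \<le> 1"
    (is "card ?S \<le> 1")
proof -
  have fin: "finite Z" using assms finite_subset by blast
  have cin: "card (flip Z e) + 1 = card Z" "\<Sum>(flip Z e) + e = \<Sum>Z" if "e \<in> Z" for e
    using that fin card_Suc_Diff1[of Z e] sum.remove[of Z e "\<lambda>x. x"] by (simp_all add: flip_in)
  have cout: "card (flip Z e) = card Z + 1" "\<Sum>(flip Z e) = \<Sum>Z + e" if "e \<notin> Z" for e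
    using that fin by (auto simp: flip_notin)
  have cong: "e = f" if "e \<in> {1..n}" "f \<in> {1..n}" "x mod n = y mod n" "x + e = y + f" for e f x y :: nat
  proof -
    have "e = f" if ef: "e \<le> f" "e \<ge> 1" "f \<le> n" "x mod n = y mod n" "x + e = y + f" for e f x y :: nat
    proof -
      have yx: "y \<le> x" "x - y = f - e" using ef by linarith+
      then have "n dvd f - e" using ef(4) mod_eq_dvd_iff_nat[of y x n] by simp
      moreover have "f - e < n" using ef by linarith
      ultimately have "f - e = 0" using nat_dvd_not_less by blast
      then show ?thesis using ef by simp
    qed
    from this[of e f x y] this[of f e y x] show ?thesis using that by (cases "e \<le> f") auto
  qed
  have "e = f" if e: "e \<in> {1..n}" "card (flip Z e) mod 4 = j" "\<Sum>(flip Z e) mod n = c"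
    and f: "f \<in> {1..n}" "card (flip Z f) mod 4 = j" "\<Sum>(flip Z f) mod n = c" for e f
  proof (cases "e \<in> Z"; cases "f \<in> Z")
    assume "e \<in> Z" "f \<in> Z"
    then show ?thesis using cin cong[OF e(1) f(1)] e f by metis
  next
    assume "e \<notin> Z" "f \<notin> Z"
    then show ?thesis using cout cong[OF f(1) e(1), of "\<Sum>(flip Z e)" "\<Sum>(flip Z f)"] e f by simp
  next
    assume "e \<in> Z" "f \<notin> Z"
    then have "card (flip Z f) = card (flip Z e) + 2" using cin(1)[of e] cout(1)[of f] by simp
    then have False using e(2) f(2) by presburger
    then show ?thesis ..
  next
    assume "e \<notin> Z" "f \<in> Z"
    then have "card (flip Z e) = card (flip Z f) + 2" using cin(1)[of f] cout(1)[of e] by simp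
    then have False using e(2) f(2) by presburger
    then show ?thesis ..
  qed
  then have eq: "\<forall>e\<in>?S. \<forall>f\<in>?S. e = f" by blast
  have fin: "finite ?S" by simp
  have "card ?S \<le> Suc 0" unfolding card_le_Suc0_iff_eq[OF fin] by (rule eq)
  then show ?thesis by (simp only: One_nat_def)
qed

lemma exists_large_residue_class:
  fixes n :: nat
  assumes "finite B" "n > 0"
  shows "\<exists>c. card B \<le> n * card {X \<in> B. f X mod n = c}"
proof (rule ccontr)
  assume "\<not> ?thesis"
  then have lt: "n * card {X \<in> B. f X mod n = c} < card B" for c by (auto simp: not_le)
  have "card B = (\<Sum>c<n. card {X \<in> B. f X mod n = c})"
    using assms by (subst card_UN_disjoint[symmetric]) (auto intro!: arg_cong[of _ _ card])
  then have "n * card B = (\<Sum>c<n. n * card {X \<in> B. f X mod n = c})"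
    by (simp add: sum_distrib_left)
  also have "\<dots> < (\<Sum>c<n. card B)" using lt assms by (intro sum_strict_mono) auto
  finally show False by simp
qed

lemma finite_even_dms: "finite {\<F>. \<F> \<subseteq> Pow {1..n} \<and> even_delta_matroid {1..n::nat} \<F>}"
  by (rule finite_subset[of _ "Pow (Pow {1..n})"]) auto

text \<open>Keeps the inner logarithm at least 1, and settles \<open>n = 1\<close> and
  \<open>n = 2\<close> in the lower bound.\<close>

lemma num_even_dm_ge_2:
  assumes "n \<ge> 1"
  shows "num_even_dm n \<ge> 2"
proof -
  have "even_delta_matroid {1..n} {{}}" "even_delta_matroid {1..n} {{1}}"
    using assms by (auto simp: even_delta_matroid_def delta_matroid_def sdiff_def)
  then have "{{{}}, {{1}}} \<subseteq> {\<F>. \<F> \<subseteq> Pow {1..n} \<and> even_delta_matroid {1..n::nat} \<F>}"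
    using assms by auto
  then have "card {{{}}, {{1::nat}}} \<le> num_even_dm n"
    unfolding num_even_dm_def by (intro card_mono finite_even_dms)
  then show ?thesis by simp
qed

lemma num_even_dm_lower:
  assumes "n \<ge> 1"
  shows "log 2 (num_even_dm n) \<ge> 2 ^ n / (2 * n)"
proof (cases "n \<ge> 3")
  case False
  then have "n = 1 \<or> n = 2" using assms by auto
  then have "2 ^ n / (2 * real n) = log 2 2" by auto
  also have "\<dots> \<le> log 2 (num_even_dm n)"
    using num_even_dm_ge_2[OF assms] by (subst log_le_cancel_iff) auto
  finally show ?thesis .
next
  case True
  let ?E = "{1..n}"
  let ?B = "\<lambda>j. {X. X \<subseteq> ?E \<and> card X mod 4 = j}"
  let ?S = "\<lambda>j c. {X. X \<subseteq> ?E \<and> card X mod 4 = j \<and> \<Sum>X mod n = c}"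
  have S: "?S j c = {X \<in> ?B j. \<Sum>X mod n = c}" for j c by auto
  have finB: "finite (?B j)" for j by (rule finite_subset[of _ "Pow ?E"]) auto
  obtain c0 where c0: "card (?B 0) \<le> n * card (?S 0 c0)"
    using exists_large_residue_class[OF finB, of n 0 "\<lambda>X. \<Sum>X"] assms S[of 0] by auto
  obtain c2 where c2: "card (?B 2) \<le> n * card (?S 2 c2)"
    using exists_large_residue_class[OF finB, of n 2 "\<lambda>X. \<Sum>X"] assms S[of 2] by auto
  \<comment> \<open>An odd set has at most one neighbour in each of the two classes, hence at most
    two in \<open>T\<close>.\<close>
  define T where "T = ?S 0 c0 \<union> ?S 2 c2"
  define V where "V = {X. X \<subseteq> ?E \<and> even (card X)}"
  have finS: "finite (?S j c)" for j c by (rule finite_subset[OF _ finB[of j]]) auto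
  have finT: "finite T" unfolding T_def using finS by blast
  have cardT: "card T = card (?S 0 c0) + card (?S 2 c2)"
    unfolding T_def using finS by (intro card_Un_disjoint) auto
  have mod4: "even k \<longleftrightarrow> k mod 4 = 0 \<or> k mod 4 = 2" for k :: nat by presburger
  have TV: "T \<subseteq> V" by (auto simp: T_def V_def mod4)
  have "V = ?B 0 \<union> ?B 2" by (auto simp: V_def mod4)
  then have "card V = card (?B 0) + card (?B 2)"
    using finB by (simp add: card_Un_disjoint disjoint_iff)
  then have "card V \<le> n * card T" using c0 c2 cardT by (simp add: algebra_simps)
  moreover have "2 * card V = 2 ^ n"
    unfolding V_def using card_parity_class[of ?E True] assms by simp
  ultimately have "2 ^ n \<le> 2 * n * card T" by simp
  then have "(2::real) ^ n \<le> 2 * real n * real (card T)"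
    by (metis of_nat_le_iff of_nat_mult of_nat_numeral of_nat_power)
  then have cT: "2 ^ n / (2 * real n) \<le> card T"
    using assms by (simp add: divide_le_eq mult.commute)
  have dm: "even_delta_matroid ?E (V - R)" if "R \<subseteq> T" for R
    unfolding V_def
  proof (rule even_delta_matroid_sparse_complement)
    fix Z assume Z: "Z \<subseteq> ?E" "odd (card Z)"
    have "card {e \<in> ?E. flip Z e \<in> R} \<le> card ({e \<in> ?E. flip Z e \<in> ?S 0 c0} \<union> {e \<in> ?E. flip Z e \<in> ?S 2 c2})"
      using that by (intro card_mono) (auto simp: T_def)
    also have "\<dots> \<le> card {e \<in> ?E. flip Z e \<in> ?S 0 c0} + card {e \<in> ?E. flip Z e \<in> ?S 2 c2}"
      by (rule card_Un_le)
    also have "\<dots> \<le> 1 + 1"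
      by (intro add_mono card_flip_residue_class Z(1))
    finally show "card {e \<in> ?E. flip Z e \<in> R} \<le> 2" by simp
  qed (use True in auto)
  have "inj_on (\<lambda>R. V - R) (Pow T)"
    using TV by (intro inj_onI) blast
  then have "card (Pow T) = card ((\<lambda>R. V - R) ` Pow T)" by (simp add: card_image)
  also have "\<dots> \<le> num_even_dm n"
    unfolding num_even_dm_def
    by (intro card_mono finite_even_dms) (use dm in \<open>auto simp: V_def\<close>)
  finally have "2 ^ card T \<le> num_even_dm n" by (simp add: card_Pow finT)
  then have "(2::real) ^ card T \<le> num_even_dm n" by (metis of_nat_le_iff of_nat_numeral of_nat_power)
  then have "real (card T) \<le> log 2 (num_even_dm n)"
    using num_even_dm_ge_2[OF assms] by (simp add: le_log_iff powr_realpow)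
  then show ?thesis using cT by linarith
qed

section \<open>Counting, isoperimetry and greedy selection\<close>

lemma sum_Pow_power_card:
  fixes x :: real
  assumes "finite U"
  shows "(\<Sum>S\<in>Pow U. x ^ card S) = (1 + x) ^ card U"
  using assms
proof (induction U rule: finite_induct)
  case (insert a U)
  have "(\<Sum>S\<in>insert a ` Pow U. x ^ card S) = (\<Sum>S\<in>Pow U. x ^ card (insert a S))"
    using insert.hyps by (subst sum.reindex) (auto simp: inj_on_def)
  also have "\<dots> = (\<Sum>S\<in>Pow U. x * x ^ card S)"
  proof (rule sum.cong[OF refl])
    fix S assume "S \<in> Pow U"
    then have "finite S" "a \<notin> S" using insert.hyps finite_subset by auto
    then show "x ^ card (insert a S) = x * x ^ card S" by simp
  qed
  finally have "(\<Sum>S\<in>insert a ` Pow U. x ^ card S) = x * (1 + x) ^ card U"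
    using insert.IH by (simp add: sum_distrib_left[symmetric])
  moreover have "Pow U \<inter> insert a ` Pow U = {}" using insert.hyps by auto
  ultimately show ?case
    using insert.hyps insert.IH by (simp add: Pow_insert sum.union_disjoint algebra_simps)
qed simp

text \<open>Weight each \<open>S\<close> by \<open>(1 / y) ^ card S\<close>: every counted set has
  weight at least \<open>y powr (- m)\<close>, and all weights together are
  \<open>(1 + 1 / y) ^ card U\<close>.\<close>

lemma card_bounded_subsets_le:
  fixes y m :: real
  assumes "finite U" "y \<ge> 1"
  shows "card {S. S \<subseteq> U \<and> card S \<le> m} \<le> y powr m * exp (card U / y)"
proof -
  let ?B = "{S. S \<subseteq> U \<and> card S \<le> m}"
  have "card ?B * y powr (- m) = (\<Sum>S\<in>?B. y powr (- m))" by simp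
  also have "\<dots> \<le> (\<Sum>S\<in>?B. (1 / y) ^ card S)"
  proof (rule sum_mono)
    fix S assume "S \<in> ?B"
    then have "y powr (- m) \<le> y powr (- card S)" using assms by (intro powr_mono) auto
    also have "\<dots> = (1 / y) ^ card S" using assms by (simp add: powr_minus powr_realpow power_one_over inverse_eq_divide)
    finally show "y powr (- m) \<le> (1 / y) ^ card S" .
  qed
  also have "\<dots> \<le> (\<Sum>S\<in>Pow U. (1 / y) ^ card S)"
    using assms by (intro sum_mono2) auto
  also have "\<dots> = (1 + 1 / y) ^ card U" using assms sum_Pow_power_card by blast
  also have "\<dots> \<le> exp (1 / y) ^ card U"
    using assms by (intro power_mono exp_ge_add_one_self) auto
  also have "\<dots> = exp (card U / y)" by (simp add: exp_of_nat_mult[symmetric])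
  finally have "card ?B * y powr (- m) \<le> exp (card U / y)" .
  then show ?thesis using assms by (simp add: powr_minus field_simps)
qed

text \<open>Induction step of the isoperimetric bound below. If \<open>a\<close> is the smaller
  part, it suffices that \<open>a + b\<close> is at least \<open>2 * a\<close> and at least
  \<open>b\<close>.\<close>

lemma entropy_split:
  fixes a b :: nat
  assumes "c \<le> a" "c \<le> b"
  shows "2 * a * log 2 a + 2 * b * log 2 b + 2 * c \<le> 2 * (a + b) * log 2 (a + b)"
proof (cases "a = 0 \<or> b = 0")
  case True
  then show ?thesis using assms by auto
next
  case False
  have step: "2 * real a * log 2 a + 2 * real b * log 2 b + 2 * real a \<le> 2 * (real a + real b) * log 2 (real a + real b)"
    if "a \<le> b" "0 < a" for a b :: nat
  proof -
    have "log 2 (2 * real a) \<le> log 2 (real a + real b)" "log 2 b \<le> log 2 (real a + real b)"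
      using that by auto
    then have "1 + log 2 a \<le> log 2 (real a + real b)" "log 2 b \<le> log 2 (real a + real b)"
      using that by (auto simp: log_mult)
    then have "a * (1 + log 2 a) \<le> a * log 2 (real a + real b)" "b * log 2 b \<le> b * log 2 (real a + real b)"
      by (auto intro!: mult_left_mono)
    then show ?thesis by (simp add: algebra_simps)
  qed
  show ?thesis
  proof (cases "a \<le> b")
    case True
    then show ?thesis using step[of a b] False assms by simp
  next
    case ba: False
    then show ?thesis using step[of b a] False assms by (simp add: algebra_simps)
  qed
qed

text \<open>Edge isoperimetry, by splitting along one coordinate \<open>a\<close>: edges in
  direction \<open>a\<close> correspond to \<open>S0 \<inter> S1\<close> and are counted from both
  ends. The factor 2 is twice the optimal one; only the order of magnitude matters.\<close>

lemma cube_degree_sum_le: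
  assumes "finite E" "S \<subseteq> Pow E"
  shows "(\<Sum>X\<in>S. card {e \<in> E. flip X e \<in> S}) \<le> 2 * card S * log 2 (card S)"
  using assms
proof (induction E arbitrary: S rule: finite_induct)
  case empty
  then have "S = {} \<or> S = {{}}" by auto
  then show ?case by auto
next
  case (insert a E)
  define S0 where "S0 = {X \<in> S. a \<notin> X}"
  \<comment> \<open>Stored without \<open>a\<close>, so that the induction hypothesis applies to
    both halves over the same \<open>E\<close>.\<close>
  define S1 where "S1 = {X. a \<notin> X \<and> insert a X \<in> S}"
  have sub: "S0 \<subseteq> Pow E" "S1 \<subseteq> Pow E" using insert.prems by (auto simp: S0_def S1_def)
  then have fin: "finite S0" "finite S1" using insert.hyps finite_subset by (meson finite_Pow_iff)+
  have a: "a \<notin> X" if "X \<in> S0 \<or> X \<in> S1" for X using that by (auto simp: S0_def S1_def)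
  have S: "S = S0 \<union> insert a ` S1"
  proof
    show "S \<subseteq> S0 \<union> insert a ` S1"
    proof
      fix X assume X: "X \<in> S"
      show "X \<in> S0 \<union> insert a ` S1"
      proof (cases "a \<in> X")
        case True
        then have "X = insert a (X - {a})" by auto
        moreover from this X have "X - {a} \<in> S1" by (auto simp: S1_def)
        ultimately show ?thesis by blast
      qed (use X in \<open>auto simp: S0_def\<close>)
    qed
  qed (auto simp: S0_def S1_def)
  have disj: "S0 \<inter> insert a ` S1 = {}" by (auto simp: S0_def)
  have inj: "inj_on (insert a) S1" by (auto simp: inj_on_def S1_def)
  have cardS: "card S = card S0 + card S1"
    using fin disj by (simp add: S card_Un_disjoint card_image inj)
  let ?d = "\<lambda>S X. card {e \<in> E. flip X e \<in> S}"
  have aE: "a \<notin> E" by fact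
  have d0: "card {e \<in> insert a E. flip X e \<in> S} = ?d S0 X + (if X \<in> S1 then 1 else 0)" if X: "X \<in> S0" for X
  proof -
    have "{e \<in> insert a E. flip X e \<in> S} = {e \<in> E. flip X e \<in> S0} \<union> (if X \<in> S1 then {a} else {})"
      using a[of X] X aE by (auto simp: S0_def S1_def sdiff_def)
    then show ?thesis using insert.hyps by (simp add: card_insert_if)
  qed
  have d1: "card {e \<in> insert a E. flip (insert a X) e \<in> S} = ?d S1 X + (if X \<in> S0 then 1 else 0)" if X: "X \<in> S1" for X
  proof -
    have "flip (insert a X) e = insert a (flip X e) \<and> a \<notin> flip X e" if "e \<in> E" for e
      using a[of X] X aE that by (auto simp: sdiff_def)
    moreover have "flip (insert a X) a = X" using a[of X] X by (auto simp: sdiff_def)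
    ultimately have "{e \<in> insert a E. flip (insert a X) e \<in> S} = {e \<in> E. flip X e \<in> S1} \<union> (if X \<in> S0 then {a} else {})"
      using a[of X] X by (auto simp: S0_def S1_def)
    then show ?thesis using insert.hyps by (simp add: card_insert_if)
  qed
  have cnt: "(\<Sum>X\<in>A. if X \<in> B then 1 else 0) = card (A \<inter> B)" if "finite A" for A B :: "'a set set"
    using that by (simp add: sum.If_cases)
  have "(\<Sum>X\<in>S. card {e \<in> insert a E. flip X e \<in> S})
      = (\<Sum>X\<in>S0. card {e \<in> insert a E. flip X e \<in> S}) + (\<Sum>X\<in>S1. card {e \<in> insert a E. flip (insert a X) e \<in> S})"
    (is "?lhs = _")
    using fin disj inj by (subst S, subst sum.union_disjoint) (auto simp: sum.reindex)
  also have "\<dots> = (\<Sum>X\<in>S0. ?d S0 X + (if X \<in> S1 then 1 else 0)) + (\<Sum>X\<in>S1. ?d S1 X + (if X \<in> S0 then 1 else 0))"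
    using d0 d1 by simp
  also have "\<dots> = (\<Sum>X\<in>S0. ?d S0 X) + (\<Sum>X\<in>S1. ?d S1 X) + 2 * card (S0 \<inter> S1)"
    using cnt[OF fin(1), of S1] cnt[OF fin(2), of S0] by (simp add: sum.distrib Int_commute)
  finally have "real ?lhs = real (\<Sum>X\<in>S0. ?d S0 X) + real (\<Sum>X\<in>S1. ?d S1 X) + 2 * real (card (S0 \<inter> S1))"
    by simp
  also have "\<dots> \<le> 2 * real (card S0) * log 2 (card S0) + 2 * real (card S1) * log 2 (card S1) + 2 * real (card (S0 \<inter> S1))"
    using insert.IH[OF sub(1)] insert.IH[OF sub(2)] by linarith
  also have "\<dots> \<le> 2 * real (card S0 + card S1) * log 2 (card S0 + card S1)"
    using entropy_split[of "card (S0 \<inter> S1)" "card S0" "card S1"] fin by (simp add: card_mono)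
  finally show ?case by (simp add: cardS)
qed

text \<open>By averaging over \<open>w\<close>, some \<open>z\<close> covers at least a fraction
  \<open>\<beta> / \<Omega>\<close> of what is still uncovered; a best \<open>z\<close> therefore
  shrinks the remainder by the factor \<open>1 - \<beta> / \<Omega>\<close> or better.\<close>

lemma greedy_fractional_cover:
  fixes w :: "'z \<Rightarrow> real" and N :: "'z \<Rightarrow> 'x set"
  assumes fin: "finite Zs" "finite U"
    and w: "\<And>z. z \<in> Zs \<Longrightarrow> w z \<ge> 0" "sum w Zs \<le> \<Omega>"
    and \<beta>: "0 < \<beta>" "\<beta> \<le> \<Omega>"
    and cov: "\<And>x. x \<in> U \<Longrightarrow> \<beta> \<le> (\<Sum>z | z \<in> Zs \<and> x \<in> N z. w z)"
  shows "\<exists>C\<subseteq>Zs. card C \<le> k \<and> card (U - \<Union>(N ` C)) \<le> (1 - \<beta> / \<Omega>) ^ k * card U"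
proof (induction k)
  case 0
  show ?case by (intro exI[of _ "{}"]) auto
next
  case (Suc k)
  then obtain C where C: "C \<subseteq> Zs" "card C \<le> k" "card (U - \<Union>(N ` C)) \<le> (1 - \<beta> / \<Omega>) ^ k * card U" by blast
  define R where "R = U - \<Union>(N ` C)"
  have finR: "finite R" using fin by (simp add: R_def)
  have nonneg: "0 \<le> 1 - \<beta> / \<Omega>" using \<beta> by (simp add: field_simps)
  show ?case
  proof (cases "R = {}")
    case True
    then have "card (U - \<Union>(N ` C)) = 0" unfolding R_def by (simp only: card.empty)
    moreover have "0 \<le> (1 - \<beta> / \<Omega>) ^ Suc k * card U"
      using nonneg by (intro mult_nonneg_nonneg zero_le_power) auto
    ultimately have "real (card (U - \<Union>(N ` C))) \<le> (1 - \<beta> / \<Omega>) ^ Suc k * card U" by linarith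
    then show ?thesis using C le_SucI by blast
  next
    case False
    let ?c = "\<lambda>z. card (R \<inter> N z)"
    obtain x where x: "x \<in> R" using False by blast
    have "Zs \<noteq> {}"
    proof
      assume "Zs = {}"
      then show False using cov[of x] x \<beta> by (simp add: R_def)
    qed
    then obtain z where z: "z \<in> Zs" "?c z = Max (?c ` Zs)"
      using Max_in[of "?c ` Zs"] fin by fastforce
    then have zmax: "?c y \<le> ?c z" if "y \<in> Zs" for y using that fin by simp
    have "\<beta> * card R = (\<Sum>x\<in>R. \<beta>)" by simp
    also have "\<dots> \<le> (\<Sum>x\<in>R. \<Sum>z | z \<in> Zs \<and> x \<in> N z. w z)"
      using cov by (intro sum_mono) (auto simp: R_def)
    also have "\<dots> = (\<Sum>z\<in>Zs. \<Sum>x | x \<in> R \<and> x \<in> N z. w z)"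
      using finR fin(1) by (intro sum.swap_restrict)
    also have "\<dots> = (\<Sum>z\<in>Zs. w z * ?c z)" by (simp add: Int_def mult.commute)
    also have "\<dots> \<le> (\<Sum>y\<in>Zs. w y * ?c z)"
      using w(1) zmax by (intro sum_mono mult_left_mono) auto
    also have "\<dots> = sum w Zs * ?c z" by (simp add: sum_distrib_right)
    also have "\<dots> \<le> \<Omega> * ?c z" using w(2) by (intro mult_right_mono) auto
    finally have ge: "\<beta> / \<Omega> * card R \<le> ?c z" using \<beta> by (simp add: field_simps)
    have "U - \<Union>(N ` insert z C) = R - R \<inter> N z" by (auto simp: R_def)
    then have "card (U - \<Union>(N ` insert z C)) = card R - ?c z"
      using finR by (simp add: card_Diff_subset)
    moreover have "?c z \<le> card R" using finR by (simp add: card_mono)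
    ultimately have "real (card (U - \<Union>(N ` insert z C))) = real (card R) - real (?c z)" by simp
    also have "\<dots> \<le> (1 - \<beta> / \<Omega>) * card R" using ge by (simp add: algebra_simps)
    also have "\<dots> \<le> (1 - \<beta> / \<Omega>) * ((1 - \<beta> / \<Omega>) ^ k * card U)"
      using C(3) nonneg by (intro mult_left_mono) (auto simp: R_def)
    finally have "real (card (U - \<Union>(N ` insert z C))) \<le> (1 - \<beta> / \<Omega>) ^ Suc k * card U" by simp
    moreover have "card (insert z C) \<le> Suc k"
      using C(2) card_insert_le_m1[of "Suc k" C z] by simp
    ultimately show ?thesis using C(1) z(1) by (intro exI[of _ "insert z C"]) auto
  qed
qed

text \<open>Take \<open>J\<close> inclusion-maximal among the families covering \<open>s\<close>
  points per member on average: any \<open>Q i\<close> with \<open>s\<close> further points could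
  still be added.\<close>

lemma greedy_packing:
  assumes "finite I" "\<And>i. i \<in> I \<Longrightarrow> finite (Q i)" "s > 0"
  shows "\<exists>J\<subseteq>I. s * card J \<le> card (\<Union>(Q ` J)) \<and> (\<forall>i\<in>I. card (Q i - \<Union>(Q ` J)) < s)"
proof -
  let ?P = "{J. J \<subseteq> I \<and> s * card J \<le> card (\<Union>(Q ` J))}"
  have finP: "finite ?P" using assms(1) by simp
  have "{} \<in> ?P" by simp
  then have "?P \<noteq> {}" by (metis empty_iff)
  from finite_has_maximal[OF finP this] obtain J where J: "J \<in> ?P" and max: "\<forall>J'\<in>?P. J \<le> J' \<longrightarrow> J = J'"
    by (elim bexE)
  have finJ: "finite J" using J assms(1) finite_subset by auto
  then have finQ: "finite (\<Union>(Q ` J))" using J assms(2) by auto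
  have "card (Q i - \<Union>(Q ` J)) < s" if i: "i \<in> I" for i
  proof (rule ccontr)
    assume ge: "\<not> ?thesis"
    then have "Q i - \<Union>(Q ` J) \<noteq> {}" using assms(3) by (metis card.empty)
    then have "i \<notin> J" by auto
    have "\<Union>(Q ` insert i J) = \<Union>(Q ` J) \<union> (Q i - \<Union>(Q ` J))" by auto
    moreover have "card (\<Union>(Q ` J) \<union> (Q i - \<Union>(Q ` J))) = card (\<Union>(Q ` J)) + card (Q i - \<Union>(Q ` J))"
      using finQ assms(2)[OF i] by (intro card_Un_disjoint) auto
    ultimately have "card (\<Union>(Q ` insert i J)) = card (\<Union>(Q ` J)) + card (Q i - \<Union>(Q ` J))"
      by (simp only:)
    then have "s * card (insert i J) \<le> card (\<Union>(Q ` insert i J))"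
      using ge J finJ \<open>i \<notin> J\<close> by simp
    then have "insert i J \<in> ?P" using J i by auto
    then have "J = insert i J" using max by (meson subset_insertI)
    then show False using \<open>i \<notin> J\<close> by blast
  qed
  then show ?thesis using J by blast
qed

text \<open>Double counting of the edges between \<open>S\<close> and \<open>T\<close>:
  \<open>(X, e)\<close> and \<open>(flip X e, e)\<close> describe one edge from its two
  ends.\<close>

lemma sum_flip_swap:
  assumes "finite S" "finite T" "finite E"
  shows "(\<Sum>X\<in>S. \<Sum>e | e \<in> E \<and> flip X e \<in> T. g X (flip X e))
       = (\<Sum>Z\<in>T. \<Sum>e | e \<in> E \<and> flip Z e \<in> S. g (flip Z e) Z)"
proof -
  have "(\<Sum>X\<in>S. \<Sum>e | e \<in> E \<and> flip X e \<in> T. g X (flip X e))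
      = (\<Sum>(X, e)\<in>(SIGMA X:S. {e. e \<in> E \<and> flip X e \<in> T}). g X (flip X e))"
    using assms by (subst sum.Sigma) auto
  also have "\<dots> = (\<Sum>(Z, e)\<in>(SIGMA Z:T. {e. e \<in> E \<and> flip Z e \<in> S}). g (flip Z e) Z)"
    by (rule sum.reindex_bij_witness[of _ "\<lambda>(Z, e). (flip Z e, e)" "\<lambda>(X, e). (flip X e, e)"]) auto
  also have "\<dots> = (\<Sum>Z\<in>T. \<Sum>e | e \<in> E \<and> flip Z e \<in> S. g (flip Z e) Z)"
    using assms by (subst sum.Sigma) auto
  finally show ?thesis .
qed

lemma card_flip_swap:
  assumes "finite S" "finite T" "finite E"
  shows "(\<Sum>X\<in>S. card {e \<in> E. flip X e \<in> T}) = (\<Sum>Z\<in>T. card {e \<in> E. flip Z e \<in> S})"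
  using sum_flip_swap[OF assms, of "\<lambda>_ _. 1 :: nat"] by simp

section \<open>Compressing an even delta-matroid\<close>

text \<open>\<open>b\<close> tells whether the feasible sets are even, so both parities are treated
  at once.\<close>

locale even_dm =
  fixes E :: "'a set" and F :: "'a set set" and b :: bool
  assumes finE: "finite E"
    and F_subset: "X \<in> F \<Longrightarrow> X \<subseteq> E"
    and F_parity: "X \<in> F \<Longrightarrow> even (card X) = b"
    and exchange: "X \<in> F \<Longrightarrow> Y \<in> F \<Longrightarrow> e \<in> sdiff X Y \<Longrightarrow> \<exists>f\<in>sdiff X Y. sdiff X {e, f} \<in> F"
begin

abbreviation n :: nat where "n \<equiv> card E"

definition V :: "bool \<Rightarrow> 'a set set" where
  "V c = {X. X \<subseteq> E \<and> even (card X) = c}"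

definition K :: "'a set set" where
  "K = V b - F"

text \<open>\<open>A Z\<close> is only meaningful for sets \<open>Z\<close> of the parity opposite to the feasible sets.\<close>

definition A :: "'a set \<Rightarrow> 'a set" where
  "A Z = {g \<in> E. flip Z g \<notin> F}"

text \<open>A \<open>good\<close> set has a feasible neighbour from which an exchange can start; a
  \<open>bad\<close> set has none.\<close>

definition bad :: "'a set set" where
  "bad = {Z \<in> V (\<not> b). A Z = E}"

definition good :: "'a set set" where
  "good = {Z \<in> V (\<not> b). A Z \<noteq> E}"

text \<open>After twisting by \<open>X\<close>, these are the loops of the rank-two matroid of feasible pairs.\<close>

definition L :: "'a set \<Rightarrow> 'a set" where
  "L X = {e \<in> E. flip X e \<in> bad}"

text \<open>The subcube through \<open>Z\<close> with free coordinates \<open>A Z\<close>, cut down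
  to the parity of the feasible sets.\<close>

definition cube :: "'a set \<Rightarrow> 'a set set" where
  "cube Z = {X \<in> V b. X - A Z = Z - A Z}"

lemma finite_V [simp]: "finite (V c)"
  unfolding V_def using finE by simp

lemma finite_derived [simp]: "finite K" "finite (A Z)" "finite bad" "finite good" "finite (L X)" "finite (cube Z)"
  unfolding K_def A_def bad_def good_def L_def cube_def using finE by auto

lemma flip_V: "X \<in> V c \<Longrightarrow> e \<in> E \<Longrightarrow> flip X e \<in> V (\<not> c)"
  unfolding V_def using flip_subset[of X E e] even_card_flip[of X e] finE finite_subset by auto

lemma K_V: "X \<in> K \<Longrightarrow> X \<in> V b"
  by (simp add: K_def)

lemma flip_K: "X \<in> K \<Longrightarrow> e \<in> E \<Longrightarrow> flip X e \<in> V (\<not> b)"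
  using flip_V K_V by blast

lemma flip_bad_or_good: "X \<in> K \<Longrightarrow> e \<in> E \<Longrightarrow> e \<notin> L X \<Longrightarrow> flip X e \<in> good"
  using flip_K[of X e] by (auto simp: L_def bad_def good_def)

lemma flip_bad_in_K:
  assumes "Z \<in> bad" "e \<in> E"
  shows "flip Z e \<in> K"
proof -
  have "flip Z e \<in> V b" using assms flip_V[of Z "\<not> b" e] by (simp add: bad_def)
  moreover have "e \<in> A Z" using assms by (simp add: bad_def)
  ultimately show ?thesis by (simp add: K_def A_def)
qed

section \<open>Consequences of exchange: infeasible subcubes and parallel classes\<close>

lemma A_subset: "A Z \<subseteq> E"
  by (auto simp: A_def)

lemma L_subset: "L X \<subseteq> E"
  by (auto simp: L_def)

lemma mem_A_flip: "X \<in> K \<Longrightarrow> e \<in> E \<Longrightarrow> e \<in> A (flip X e)"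
  by (simp add: A_def K_def)

text \<open>An exchange at \<open>h\<close> from a feasible neighbour \<open>flip Z h\<close>
  towards \<open>sdiff Z D\<close> would end in \<open>Z\<close>, which has the wrong parity, or in
  \<open>flip Z f\<close> with \<open>f\<close> in \<open>D\<close>, which is infeasible because
  \<open>D\<close> lies in \<open>A Z\<close>.\<close>

lemma good_avoids_F:
  assumes Z: "Z \<in> good" and D: "D \<subseteq> A Z"
  shows "sdiff Z D \<notin> F"
proof
  assume Y: "sdiff Z D \<in> F"
  obtain h where h: "h \<in> E" "flip Z h \<in> F" "h \<notin> D"
    using Z D by (auto simp: good_def A_def)
  have sd: "sdiff (flip Z h) (sdiff Z D) = insert h D"
    using h(3) by (auto simp: sdiff_def)
  obtain f where f: "f \<in> insert h D" "sdiff (flip Z h) {h, f} \<in> F"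
    using exchange[OF h(2) Y, of h] unfolding sd by blast
  show False
  proof (cases "f = h")
    case True
    then have "Z \<in> F" using f(2) by simp
    then show False using Z F_parity by (auto simp: good_def V_def)
  next
    case False
    then have "f \<in> D" "flip Z f \<in> F"
      using f sdiff_pair[of h f "flip Z h"] by auto
    then show False using D by (auto simp: A_def)
  qed
qed

lemma cube_subset_K:
  assumes "Z \<in> good"
  shows "cube Z \<subseteq> K"
proof
  fix X assume X: "X \<in> cube Z"
  have "sdiff Z X \<subseteq> A Z" using X by (auto simp: cube_def sdiff_def)
  then have "sdiff Z (sdiff Z X) \<notin> F" using good_avoids_F assms by blast
  moreover have "sdiff Z (sdiff Z X) = X" by (auto simp: sdiff_def)
  ultimately show "X \<in> K" using X by (simp add: K_def cube_def)
qed

text \<open>Parallelism of non-loops in the rank-two matroid at \<open>X\<close> is transitive.\<close>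

lemma A_flip_eq:
  assumes X: "X \<in> K" and e: "e \<in> E - L X" and f: "f \<in> A (flip X e) - L X"
  shows "A (flip X f) = A (flip X e)"
proof -
  have sub: "A (flip X f) \<subseteq> A (flip X e)"
    if e: "e \<in> E - L X" and f: "f \<in> A (flip X e) - L X" for e f
  proof
    fix g assume g: "g \<in> A (flip X f)"
    show "g \<in> A (flip X e)"
    proof (cases "g = e \<or> g = f \<or> e = f")
      case True
      then show ?thesis using e f g mem_A_flip[OF X] by auto
    next
      case False
      have fE: "f \<in> E" using f A_subset by blast
      then have "flip X f \<in> good" using flip_bad_or_good X f by blast
      \<comment> \<open>\<open>f\<close> belongs because \<open>X\<close> is infeasible,
        \<open>e\<close> by symmetry. Flipping all three in \<open>flip X f\<close> gives
        \<open>flip (flip X e) g\<close>.\<close>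
      moreover have "{f, e, g} \<subseteq> A (flip X f)"
        using mem_A_flip[OF X fE] e f g by (auto simp: A_def flip_commute[of X e])
      ultimately have "sdiff (flip X f) {f, e, g} \<notin> F" by (rule good_avoids_F)
      moreover have "sdiff (flip X f) {f, e, g} = flip (flip X e) g"
        using False by (auto simp: sdiff_def)
      ultimately show ?thesis using g by (simp add: A_def)
    qed
  qed
  have "f \<in> E - L X" "e \<in> A (flip X f) - L X"
    using e f by (auto simp: A_def flip_commute[of X e])
  then show ?thesis using sub[OF e f] sub[of f e] by blast
qed

text \<open>
  Together with \<open>w_cover_ge\<close>: moving from X along a loop g and a non-loop p leads to a member of K
  whose loop set is not much larger, so weighting each bad set by the reciprocal loop numbers
  around it gives a fractional cover of small total weight.
\<close>

lemma L_flip_flip: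
  assumes X: "X \<in> K" and g: "g \<in> L X" and p: "p \<in> E - L X"
  shows "flip (flip X g) p \<in> K" "L (flip (flip X g) p) \<subseteq> A (flip X p)"
    "p \<in> L (flip (flip X g) p)"
proof -
  show K: "flip (flip X g) p \<in> K" using flip_bad_in_K g p by (auto simp: L_def)
  show "p \<in> L (flip (flip X g) p)" using g p by (auto simp: L_def)
  show "L (flip (flip X g) p) \<subseteq> A (flip X p)"
  proof
    fix q assume q: "q \<in> L (flip (flip X g) p)"
    have "g \<in> E" using g by (simp add: L_def)
    \<comment> \<open>Flipping \<open>q\<close> gives a bad set, so undoing the flip of
      \<open>g\<close> afterwards leads to an infeasible set.\<close>
    then have "flip (flip (flip (flip X g) p) q) g \<in> K"
      using flip_bad_in_K q by (auto simp: L_def)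
    moreover have "flip (flip (flip (flip X g) p) q) g = flip (flip X p) q"
      by (auto simp: sdiff_def)
    ultimately show "q \<in> A (flip X p)" using q by (simp add: A_def K_def L_def)
  qed
qed

section \<open>Cardinality bounds from parity classes\<close>

lemma card_V:
  assumes "E \<noteq> {}"
  shows "real (card (V c)) = 2 ^ n / 2"
  using card_parity_class[OF finE assms, of c] unfolding V_def
  by (metis nonzero_mult_div_cancel_left of_nat_mult of_nat_numeral of_nat_power zero_neq_numeral)

lemma card_le_V:
  assumes "E \<noteq> {}" "S \<subseteq> V c"
  shows "real (card S) \<le> 2 ^ n / 2"
  using card_mono[OF finite_V assms(2)] card_V[OF assms(1), of c] by linarith

text \<open>Double counting: each \<open>X\<close> in \<open>S\<close> has at least
  \<open>n / 4\<close> neighbours \<open>Z\<close> with small \<open>A Z\<close>, and each such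
  \<open>Z\<close> has at most \<open>t\<close> neighbours in \<open>S\<close>, since these are
  infeasible and so arise from \<open>A Z\<close>.\<close>

lemma card_small_neighbourhoods:
  assumes "E \<noteq> {}" "t \<ge> 0"
    and S: "S \<subseteq> K" "\<And>X. X \<in> S \<Longrightarrow> n \<le> 4 * card {e \<in> E. real (card (A (flip X e))) \<le> t}"
  shows "real n * card S \<le> 2 * t * 2 ^ n"
proof -
  define T where "T = {Z \<in> V (\<not> b). real (card (A Z)) \<le> t}"
  have finS: "finite S" by (rule finite_subset[OF S(1)]) simp
  have finT: "finite T" by (simp add: T_def)
  have "real n * card S = (\<Sum>X\<in>S. real n)" by simp
  also have "\<dots> \<le> (\<Sum>X\<in>S. 4 * real (card {e \<in> E. flip X e \<in> T}))"
  proof (rule sum_mono)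
    fix X assume X: "X \<in> S"
    then have "{e \<in> E. flip X e \<in> T} = {e \<in> E. real (card (A (flip X e))) \<le> t}"
      using S(1) flip_K by (auto simp: T_def)
    then show "real n \<le> 4 * real (card {e \<in> E. flip X e \<in> T})"
      using S(2)[OF X] by simp
  qed
  also have "\<dots> = 4 * real (\<Sum>X\<in>S. card {e \<in> E. flip X e \<in> T})" by (simp add: sum_distrib_left)
  also have "\<dots> = 4 * (\<Sum>Z\<in>T. real (card {e \<in> E. flip Z e \<in> S}))"
    by (subst card_flip_swap[OF finS finT finE]) simp
  also have "\<dots> \<le> 4 * (\<Sum>Z\<in>T. t)"
  proof (intro mult_left_mono sum_mono)
    fix Z assume Z: "Z \<in> T"
    have "card {e \<in> E. flip Z e \<in> S} \<le> card (A Z)"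
      using S(1) by (intro card_mono) (auto simp: A_def K_def finE)
    then show "real (card {e \<in> E. flip Z e \<in> S}) \<le> t" using Z by (simp add: T_def)
  qed simp
  also have "\<dots> = 4 * t * card T" by simp
  also have "\<dots> \<le> 4 * t * (2 ^ n / 2)"
    using card_le_V[OF assms(1), of T] assms(2) by (intro mult_left_mono) (auto simp: T_def)
  finally show ?thesis by simp
qed

section \<open>Fractional covering by bad sets\<close>

definition w :: "'a set \<Rightarrow> real" where
  "w Z = 1 + (\<Sum>e\<in>E. 1 / card (L (flip Z e)))"

text \<open>After swapping sums, each \<open>X\<close> in \<open>K\<close> receives
  \<open>1 / card (L X)\<close> from each of its loops, at most 1 in all. The summands 1 in
  \<open>w\<close> add \<open>card bad\<close>. Either part is at most half of
  \<open>2 ^ n\<close>.\<close>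

lemma sum_w_le:
  assumes "E \<noteq> {}"
  shows "sum w bad \<le> 2 ^ n"
proof -
  have "(\<Sum>Z\<in>bad. \<Sum>e\<in>E. 1 / real (card (L (flip Z e))))
      = (\<Sum>Z\<in>bad. \<Sum>e | e \<in> E \<and> flip Z e \<in> K. 1 / real (card (L (flip Z e))))"
    by (intro sum.cong refl) (auto dest: flip_bad_in_K)
  also have "\<dots> = (\<Sum>X\<in>K. \<Sum>e | e \<in> E \<and> flip X e \<in> bad. 1 / real (card (L X)))"
    using sum_flip_swap[of K bad E "\<lambda>X _. 1 / real (card (L X))"] finE by simp
  \<comment> \<open>Not an equality in general: an \<open>X\<close> without loops contributes
    0.\<close>
  also have "\<dots> \<le> (\<Sum>X\<in>K. 1)"
    by (intro sum_mono) (simp add: L_def)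
  also have "\<dots> \<le> 2 ^ n / 2" using card_le_V[OF assms, of K b] by (simp add: K_def)
  finally show ?thesis
    using card_le_V[OF assms, of bad "\<not> b"] by (simp add: w_def sum.distrib bad_def)
qed

text \<open>The bad neighbours of \<open>X\<close> are its flips at loops. With \<open>n / 4\<close>
  loops the summand 1 in \<open>w\<close> suffices. Otherwise each of the \<open>l\<close> loops
  combines with at least \<open>n / 4\<close> non-loops leading to sets with at most
  \<open>2 * l\<close> loops, which gives \<open>l * (n / 4) / (2 * l) = n / 8\<close>.\<close>

lemma w_cover_ge:
  assumes "X \<in> K"
    and "n \<le> 4 * card (L X) \<or> n \<le> 4 * card {e \<in> E - L X. card (A (flip X e)) \<le> 2 * card (L X)}"
  shows "n / 8 \<le> (\<Sum>Z | Z \<in> bad \<and> X \<in> flip Z ` E. w Z)"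
proof -
  have "{Z. Z \<in> bad \<and> X \<in> flip Z ` E} = flip X ` L X"
  proof (intro equalityI subsetI)
    fix Z assume "Z \<in> {Z. Z \<in> bad \<and> X \<in> flip Z ` E}"
    then obtain e where "e \<in> E" "Z \<in> bad" "X = flip Z e" by auto
    then have "e \<in> L X" "Z = flip X e" by (auto simp: L_def)
    then show "Z \<in> flip X ` L X" by blast
  next
    fix Z assume "Z \<in> flip X ` L X"
    then obtain e where e: "e \<in> E" "flip X e \<in> bad" "Z = flip X e" by (auto simp: L_def)
    then have "X = flip Z e" by simp
    then have "X \<in> flip Z ` E" using e(1) by blast
    moreover have "Z \<in> bad" using e(2,3) by simp
    ultimately show "Z \<in> {Z. Z \<in> bad \<and> X \<in> flip Z ` E}" by simp
  qed
  moreover have "inj_on (flip X) (L X)" by (auto simp: inj_on_def inj_flip)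
  ultimately have eq: "(\<Sum>Z | Z \<in> bad \<and> X \<in> flip Z ` E. w Z) = (\<Sum>g\<in>L X. w (flip X g))"
    by (simp add: sum.reindex)
  show ?thesis
  proof (cases "n \<le> 4 * card (L X)")
    case True
    have "real n / 8 \<le> (\<Sum>g\<in>L X. 1)" using True by simp
    also have "\<dots> \<le> (\<Sum>g\<in>L X. w (flip X g))"
      by (intro sum_mono) (auto simp: w_def intro!: sum_nonneg)
    finally show ?thesis using eq by simp
  next
    case False
    let ?l = "card (L X)"
    let ?P = "{e \<in> E - L X. card (A (flip X e)) \<le> 2 * ?l}"
    have P: "n \<le> 4 * card ?P" using assms(2) False by simp
    \<comment> \<open>\<open>A (flip X e)\<close> contains \<open>e\<close>, so bounding its size by
      twice the loop number forces a loop.\<close>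
    have lpos: "?l > 0"
    proof -
      have "card ?P > 0" using P False by linarith
      then obtain e where e: "e \<in> E" "card (A (flip X e)) \<le> 2 * ?l"
        by (auto simp: card_gt_0_iff)
      have "card (A (flip X e)) > 0"
        using mem_A_flip[OF assms(1) e(1)] by (auto simp: card_gt_0_iff)
      then show ?thesis using e(2) by linarith
    qed
    have ge: "card ?P / (2 * ?l) \<le> w (flip X g)" if g: "g \<in> L X" for g
    proof -
      have "card ?P / (2 * ?l) = (\<Sum>e\<in>?P. 1 / (2 * real ?l))" by simp
      also have "\<dots> \<le> (\<Sum>e\<in>?P. 1 / card (L (flip (flip X g) e)))"
      proof (rule sum_mono)
        fix p assume p: "p \<in> ?P"
        note LL = L_flip_flip[OF assms(1) g, of p]
        have "card (L (flip (flip X g) p)) \<le> card (A (flip X p))"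
          using LL(2) p by (intro card_mono) auto
        also have "\<dots> \<le> 2 * ?l" using p by simp
        finally have "card (L (flip (flip X g) p)) \<le> 2 * ?l" .
        moreover have "card (L (flip (flip X g) p)) > 0"
          using LL(3) p by (auto simp: card_gt_0_iff)
        ultimately show "1 / (2 * real ?l) \<le> 1 / card (L (flip (flip X g) p))"
          by (intro divide_left_mono) auto
      qed
      also have "\<dots> \<le> (\<Sum>e\<in>E. 1 / card (L (flip (flip X g) e)))"
        using finE by (intro sum_mono2) auto
      finally show ?thesis by (simp add: w_def)
    qed
    have "real n / 8 \<le> card ?P / 2" using P by linarith
    also have "\<dots> = ?l * (card ?P / (2 * ?l))" using lpos by auto
    also have "\<dots> = (\<Sum>g\<in>L X. card ?P / (2 * ?l))" by simp
    also have "\<dots> \<le> (\<Sum>g\<in>L X. w (flip X g))" by (intro sum_mono ge)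
    finally show ?thesis using eq by simp
  qed
qed

text \<open>Greedy covering with \<open>\<beta> = n / 8\<close> and \<open>\<Omega> = 2 ^ n\<close>:
  about \<open>8 * 2 ^ n / n * ln n\<close> steps leave at most a fraction \<open>1 / n\<close>
  uncovered.\<close>

lemma exists_bad_cover:
  assumes n: "n \<ge> 2"
    and U: "U \<subseteq> K" "\<And>X. X \<in> U \<Longrightarrow>
      n \<le> 4 * card (L X) \<or> n \<le> 4 * card {e \<in> E - L X. card (A (flip X e)) \<le> 2 * card (L X)}"
  shows "\<exists>C\<subseteq>bad. card C \<le> 9 * 2 ^ n / n * log 2 n \<and> card (U - (\<Union>Z\<in>C. flip Z ` E)) \<le> 2 ^ n / n"
proof -
  have E: "E \<noteq> {}" using n by auto
  have finU: "finite U" by (rule finite_subset[OF U(1)]) simp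
  have n2: "real n \<le> 2 ^ n" by (simp add: less_imp_le)
  define x where "x = 8 * 2 ^ n / n * ln n"
  define k where "k = nat \<lceil>x\<rceil>"
  have lnpos: "ln (real n) \<ge> 0" using n by simp
  have x0: "x \<ge> 0" using lnpos by (simp add: x_def)
  have k: "x \<le> k" "k \<le> x + 1" using x0 by (auto simp: k_def)
  have "\<exists>C\<subseteq>bad. card C \<le> k \<and>
      card (U - (\<Union>Z\<in>C. flip Z ` E)) \<le> (1 - (n / 8) / 2 ^ n) ^ k * card U"
  proof (rule greedy_fractional_cover)
    show "0 \<le> w Z" for Z by (auto simp: w_def intro!: add_nonneg_nonneg sum_nonneg)
    show "real n / 8 \<le> (\<Sum>Z | Z \<in> bad \<and> X \<in> flip Z ` E. w Z)" if "X \<in> U" for X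
      using that U by (intro w_cover_ge) auto
    show "real n / 8 \<le> 2 ^ n" using n2 by linarith
  qed (use finU sum_w_le[OF E] n in auto)
  then obtain C where C: "C \<subseteq> bad" "card C \<le> k"
    "card (U - (\<Union>Z\<in>C. flip Z ` E)) \<le> (1 - (n / 8) / 2 ^ n) ^ k * card U"
    by blast
  let ?\<delta> = "(real n / 8) / 2 ^ n"
  have "U \<subseteq> V b" using U(1) by (auto simp: K_def)
  from card_le_V[OF E this] have cU: "real (card U) \<le> 2 ^ n" using n2 by linarith
  have "real n \<le> 8 * 2 ^ n" using n2 by linarith
  then have "0 \<le> 1 - ?\<delta>" by (simp add: field_simps)
  then have "(1 - ?\<delta>) ^ k \<le> exp (- ?\<delta>) ^ k"
    using exp_ge_add_one_self[of "- ?\<delta>"] by (intro power_mono) auto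
  also have "\<dots> = exp (- (?\<delta> * k))" by (simp add: exp_of_nat_mult[symmetric] mult.commute)
  also have "\<dots> \<le> exp (- (?\<delta> * x))" using k by (simp add: mult_left_mono divide_right_mono)
  also have "?\<delta> * x = ln n" using n by (simp add: x_def)
  also have "exp (- ln n) = 1 / n" using n by (simp add: exp_minus inverse_eq_divide)
  finally have "(1 - ?\<delta>) ^ k * card U \<le> 1 / n * 2 ^ n"
    by (intro mult_mono cU) auto
  then have c2: "card (U - (\<Union>Z\<in>C. flip Z ` E)) \<le> 2 ^ n / n" using C(3) by simp
  have "ln 2 < (1::real)" using ln_2_less_1 .
  then have "ln n \<le> log 2 n" using lnpos by (simp add: log_def le_divide_eq mult_left_le)
  then have "x \<le> 8 * 2 ^ n / n * log 2 n" unfolding x_def by (intro mult_left_mono) auto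
  \<comment> \<open>Pays for rounding \<open>x\<close> up to an integer, turning the factor 8 into
    9.\<close>
  moreover have "1 * 1 \<le> 2 ^ n / n * log 2 n"
    using n n2 by (intro mult_mono) (auto simp: le_log_iff field_simps)
  ultimately have "k \<le> 9 * 2 ^ n / n * log 2 n" using k by (simp add: field_simps)
  then have "card C \<le> 9 * 2 ^ n / n * log 2 n" using C(2) by linarith
  then show ?thesis using C(1) c2 by blast
qed

section \<open>Rich sets and packed subcubes\<close>

text \<open>The key of \<open>Z\<close> determines \<open>cube Z\<close>: free coordinates, and the fixed ones that are present.\<close>

definition key :: "'a set \<Rightarrow> 'a set \<times> 'a set" where
  "key Z = (A Z, Z - A Z)"

text \<open>The condition on loops leaves more than half of \<open>A (flip X e)\<close> as
  non-loops; by \<open>key_flip_eq\<close> these all give the same subcube.\<close>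

definition rich :: "real \<Rightarrow> 'a set \<Rightarrow> 'a set" where
  "rich t X = {e \<in> E - L X. t < card (A (flip X e)) \<and> 2 * card (L X) < card (A (flip X e))}"

lemma rich_subset: "rich t X \<subseteq> E"
  by (auto simp: rich_def)

text \<open>The free coordinates agree by \<open>A_flip_eq\<close>; both \<open>e\<close> and
  \<open>f\<close> are among them, so neither flip changes the fixed coordinates.\<close>

lemma key_flip_eq:
  assumes "X \<in> K" "e \<in> E - L X" "f \<in> A (flip X e) - L X"
  shows "flip X f \<in> good" "key (flip X f) = key (flip X e)"
proof -
  have f: "f \<in> E" "f \<notin> L X" using assms(3) A_subset by auto
  then show "flip X f \<in> good" using flip_bad_or_good assms(1) by blast
  have eq: "A (flip X f) = A (flip X e)" by (rule A_flip_eq[OF assms])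
  have "e \<in> A (flip X e)" using mem_A_flip assms by blast
  then show "key (flip X f) = key (flip X e)"
    unfolding key_def eq using assms(3) by (auto simp: sdiff_def)
qed

text \<open>
  The members of W in a cube number less than n^2, so in the subgraph of the cube graph they span
  together with their neighbours the average degree is O(log n); since each member of Xs has degree
  at least t / 2, the Zs must account for most of the vertices.
\<close>

lemma rich_class_incidences_le:
  assumes n: "n \<ge> 2" and W: "W \<subseteq> K" and Z: "Z \<in> good"
    and small: "card (W \<inter> cube Z) < n\<^sup>2"
    and t: "t = 32 * log 2 n"
    and Zs: "Zs = {Y \<in> good. key Y = key Z}"
    and Xs: "Xs = {X \<in> W. \<exists>e\<in>rich t X. key (flip X e) = key Z}"
  shows "real (\<Sum>X\<in>Xs. card {e \<in> E. flip X e \<in> Zs}) \<le> 16 * log 2 n * card Zs"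
proof -
  define I where "I = (\<Sum>X\<in>Xs. card {e \<in> E. flip X e \<in> Zs})"
  define Ys where "Ys = {Y \<in> Zs. \<exists>X\<in>Xs. Y \<in> flip X ` E}"
  have finW: "finite W" by (rule finite_subset[OF W]) simp
  have fin: "finite Xs" "finite Zs" "finite Ys" using finW by (auto simp: Xs Zs Ys_def)
  have n1: "real n \<ge> 2" using n by simp
  have lg: "log 2 n \<ge> 1" using n1 by (simp add: le_log_iff)
  have XsK: "Xs \<subseteq> K" using W by (auto simp: Xs)
  have "Xs \<subseteq> W \<inter> cube Z"
  proof
    fix X assume X: "X \<in> Xs"
    then obtain e where e: "e \<in> rich t X" "key (flip X e) = key Z" and XW: "X \<in> W" by (auto simp: Xs)
    have XK: "X \<in> K" using XW W by blast
    have "e \<in> A (flip X e)" using mem_A_flip[OF XK] e rich_subset by blast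
    then have "X - A Z = Z - A Z" using e(2) by (auto simp: key_def sdiff_def)
    then show "X \<in> W \<inter> cube Z" using XW K_V[OF XK] by (simp add: cube_def)
  qed
  then have "card Xs \<le> card (W \<inter> cube Z)" by (intro card_mono) (auto simp: finW)
  then have cX: "card Xs \<le> n\<^sup>2" using small by simp
  have deg: "t / 2 \<le> card {e \<in> E. flip X e \<in> Zs}" if X: "X \<in> Xs" for X
  proof -
    obtain e where e: "e \<in> rich t X" "key (flip X e) = key Z" and XW: "X \<in> W" using X by (auto simp: Xs)
    have XK: "X \<in> K" using XW W by blast
    have eE: "e \<in> E - L X" using e by (auto simp: rich_def)
    have "A (flip X e) - L X \<subseteq> {e \<in> E. flip X e \<in> Zs}"
      using key_flip_eq[OF XK eE] e(2) A_subset by (auto simp: Zs)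
    then have "card (A (flip X e) - L X) \<le> card {e \<in> E. flip X e \<in> Zs}"
      using finE by (intro card_mono) auto
    moreover have "card (A (flip X e) - L X) \<ge> card (A (flip X e)) - card (L X)"
      by (simp add: diff_card_le_card_Diff)
    moreover have "t < card (A (flip X e))" "2 * card (L X) < card (A (flip X e))"
      using e by (auto simp: rich_def)
    ultimately show ?thesis by linarith
  qed
  have "t / 2 * card Xs = (\<Sum>X\<in>Xs. t / 2)" by simp
  also have "\<dots> \<le> (\<Sum>X\<in>Xs. real (card {e \<in> E. flip X e \<in> Zs}))" by (intro sum_mono deg)
  finally have tX: "t / 2 * card Xs \<le> I" by (simp add: I_def)
  define S where "S = Xs \<union> Ys"
  have SE: "S \<subseteq> Pow E" using XsK by (auto simp: S_def Ys_def Zs K_def V_def good_def)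
  have finS: "finite S" using fin by (simp add: S_def)
  have "Ys \<subseteq> (\<Union>X\<in>Xs. flip X ` E)" by (auto simp: Ys_def)
  then have "card Ys \<le> card (\<Union>X\<in>Xs. flip X ` E)" using fin finE by (intro card_mono) auto
  also have "\<dots> \<le> (\<Sum>X\<in>Xs. card (flip X ` E))" using fin(1) by (rule card_UN_le)
  also have "\<dots> \<le> (\<Sum>X\<in>Xs. n)" by (intro sum_mono card_image_le finE)
  finally have cY: "card Ys \<le> card Xs * n" by simp
  have cS1: "card S \<le> card Xs + card Ys" unfolding S_def by (rule card_Un_le)
  also have "\<dots> \<le> card Xs * (n + 1)" using cY by simp
  also have "\<dots> \<le> n\<^sup>2 * n\<^sup>2"
  proof (intro mult_mono cX)
    have "n + 1 \<le> 2 * n" using n by simp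
    also have "\<dots> \<le> n * n" using n by (intro mult_right_mono) auto
    finally show "n + 1 \<le> n\<^sup>2" by (simp add: power2_eq_square)
  qed auto
  finally have cS: "card S \<le> n ^ 4" by (simp add: power_add[symmetric])
  have logS: "log 2 (card S) \<le> 4 * log 2 n" if "card S > 0"
  proof -
    have "real (card S) \<le> real n ^ 4" using cS by (metis of_nat_le_iff of_nat_power)
    then have "log 2 (card S) \<le> log 2 (real n ^ 4)" using that n by (subst log_le_cancel_iff) auto
    also have "\<dots> = 4 * log 2 n" using n by (simp add: log_nat_power)
    finally show ?thesis .
  qed
  have "I \<le> (\<Sum>X\<in>Xs. card {e \<in> E. flip X e \<in> S})"
    unfolding I_def
  proof (intro sum_mono card_mono)
    fix X assume "X \<in> Xs"
    then show "{e \<in> E. flip X e \<in> Zs} \<subseteq> {e \<in> E. flip X e \<in> S}"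
      by (auto simp: S_def Ys_def)
  qed (use finE in auto)
  also have "\<dots> \<le> (\<Sum>X\<in>S. card {e \<in> E. flip X e \<in> S})"
    using finS by (intro sum_mono2) (auto simp: S_def)
  finally have "real I \<le> real (\<Sum>X\<in>S. card {e \<in> E. flip X e \<in> S})" by (simp only: of_nat_le_iff)
  also have "\<dots> \<le> 2 * card S * log 2 (card S)" by (rule cube_degree_sum_le[OF finE SE])
  also have "\<dots> \<le> 2 * card S * (4 * log 2 n)"
  proof (cases "card S > 0")
    case True
    then show ?thesis using logS by (intro mult_left_mono) auto
  next
    case False
    then have "card S = 0" by simp
    then show ?thesis by (simp only: mult_0_right of_nat_0 mult_zero_left order_refl)
  qed
  also have "\<dots> = 8 * log 2 n * real (card S)" by simp
  also have "\<dots> \<le> 8 * log 2 n * (real (card Xs) + real (card Ys))"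
    using cS1 lg by (intro mult_left_mono) auto
  \<comment> \<open>\<open>t\<close> is chosen so that the \<open>Xs\<close> term is half of a lower
    bound for \<open>I\<close> and can be absorbed on the left.\<close>
  also have "\<dots> = (t / 2 * card Xs) / 2 + 8 * log 2 n * card Ys" by (simp add: t algebra_simps)
  also have "\<dots> \<le> I / 2 + 8 * log 2 n * card Ys" using tX by simp
  finally have "real I \<le> 16 * log 2 n * card Ys" by simp
  also have "\<dots> \<le> 16 * log 2 n * card Zs"
    using lg fin by (intro mult_left_mono) (auto simp: Ys_def intro!: card_mono)
  finally show ?thesis by (simp add: I_def)
qed

text \<open>Pairs \<open>(X, e)\<close> with \<open>e\<close> in \<open>rich t X\<close> are grouped
  by the key of \<open>flip X e\<close>. The bounds per class sum to
  \<open>16 * log 2 n * card good\<close>, while each \<open>X\<close> lies in at least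
  \<open>n / 4\<close> pairs.\<close>

lemma card_rich_leftover_le:
  assumes n: "n \<ge> 2" and W: "W \<subseteq> K" and t: "t = 32 * log 2 n"
    and rich: "\<And>X. X \<in> W \<Longrightarrow> n \<le> 4 * card (rich t X)"
    and small: "\<And>Z. Z \<in> good \<Longrightarrow> card (W \<inter> cube Z) < n\<^sup>2"
  shows "real n * card W \<le> 32 * log 2 n * 2 ^ n"
proof -
  define Zs where "Zs = (\<lambda>k. {Y \<in> good. key Y = k})"
  define Xs where "Xs = (\<lambda>k. {X \<in> W. \<exists>e\<in>rich t X. key (flip X e) = k})"
  define P where "P = (\<lambda>k. SIGMA X:Xs k. {e \<in> E. flip X e \<in> Zs k})"
  have E: "E \<noteq> {}" using n by auto
  have finW: "finite W" by (rule finite_subset[OF W]) simp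
  have finX: "finite (Xs k)" for k using finW by (simp add: Xs_def)
  have finr: "finite (rich t X)" for X using rich_subset finE finite_subset by blast
  have finP: "finite (P k)" for k using finX finE by (auto simp: P_def)
  have lg: "log 2 n \<ge> 1" using n by (simp add: le_log_iff)
  have sub: "(SIGMA X:W. rich t X) \<subseteq> (\<Union>k\<in>key ` good. P k)"
  proof
    fix p assume "p \<in> (SIGMA X:W. rich t X)"
    then obtain X e where p: "p = (X, e)" "X \<in> W" "e \<in> rich t X" by auto
    have "e \<in> E" "e \<notin> L X" using p by (auto simp: rich_def)
    then have g: "flip X e \<in> good" using flip_bad_or_good p(2) W by blast
    have "p \<in> P (key (flip X e))"
      using p g \<open>e \<in> E\<close> by (auto simp: P_def Xs_def Zs_def)
    then show "p \<in> (\<Union>k\<in>key ` good. P k)" using g by blast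
  qed
  have "real n * card W = (\<Sum>X\<in>W. real n)" by simp
  also have "\<dots> \<le> (\<Sum>X\<in>W. 4 * real (card (rich t X)))"
    using rich by (intro sum_mono) (metis of_nat_le_iff of_nat_mult of_nat_numeral)
  also have "\<dots> = 4 * real (card (SIGMA X:W. rich t X))"
    using finW finr by (simp add: card_SigmaI sum_distrib_left)
  also have "\<dots> \<le> 4 * (\<Sum>k\<in>key ` good. real (card (P k)))"
  proof -
    have "card (SIGMA X:W. rich t X) \<le> card (\<Union>k\<in>key ` good. P k)"
      using sub finP by (intro card_mono) auto
    also have "\<dots> \<le> (\<Sum>k\<in>key ` good. card (P k))" by (intro card_UN_le) simp
    finally show ?thesis by (simp add: of_nat_sum[symmetric] del: of_nat_sum)
  qed
  also have "\<dots> \<le> 4 * (\<Sum>k\<in>key ` good. 16 * log 2 n * card (Zs k))"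
  proof (intro mult_left_mono sum_mono)
    fix k assume "k \<in> key ` good"
    then obtain Z where Z: "Z \<in> good" "k = key Z" by blast
    have "real (\<Sum>X\<in>Xs k. card {e \<in> E. flip X e \<in> Zs k}) \<le> 16 * log 2 n * card (Zs k)"
      by (rule rich_class_incidences_le[OF n W Z(1) small[OF Z(1)] t]) (auto simp: Xs_def Zs_def Z(2))
    then show "real (card (P k)) \<le> 16 * log 2 n * card (Zs k)"
      using finX finE by (simp add: P_def card_SigmaI)
  qed simp
  also have "\<dots> = 64 * log 2 n * real (\<Sum>k\<in>key ` good. card (Zs k))"
    by (simp add: sum_distrib_left mult.assoc)
  also have "(\<Sum>k\<in>key ` good. card (Zs k)) = card good"
    using sum.image_gen[of good "\<lambda>_. 1 :: nat" key] by (simp add: Zs_def)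
  also have "64 * log 2 n * real (card good) \<le> 64 * log 2 n * (2 ^ n / 2)"
    using lg card_le_V[OF E, of good "\<not> b"] by (intro mult_left_mono) (auto simp: good_def)
  finally show ?thesis by (simp add: mult_ac)
qed

text \<open>\<open>I\<close> lists the infeasible sets left over in the three cases,
  \<open>C\<close> consists of bad sets, all of whose neighbours are infeasible, and
  \<open>G\<close> of the keys of the packed subcubes.\<close>

lemma compressed_description:
  assumes n: "n \<ge> 2"
  shows "\<exists>I C G. I \<subseteq> Pow E \<and> C \<subseteq> Pow E \<and> G \<subseteq> Pow E \<times> Pow E
    \<and> card I \<le> 100 * 2 ^ n / n * log 2 n \<and> card C \<le> 100 * 2 ^ n / n * log 2 n \<and> card G \<le> 2 ^ n / n\<^sup>2
    \<and> F = {X. X \<subseteq> E \<and> even (card X) = b} - (I \<union> (\<Union>Z\<in>C. flip Z ` E) \<union> {X. \<exists>(H, R)\<in>G. X - H = R})"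
proof -
  have E: "E \<noteq> {}" using n by auto
  have n0: "real n > 0" using n by simp
  have lg: "log 2 n \<ge> 1" using n by (simp add: le_log_iff)
  define t where "t = 32 * log 2 n"
  define S where "S = {X \<in> K. n \<le> 4 * card {e \<in> E. real (card (A (flip X e))) \<le> t}}"
  define U where "U = {X \<in> K. n \<le> 4 * card (L X) \<or> n \<le> 4 * card {e \<in> E - L X. card (A (flip X e)) \<le> 2 * card (L X)}}"
  obtain C where C: "C \<subseteq> bad" "card C \<le> 9 * 2 ^ n / n * log 2 n"
      "card (U - (\<Union>Z\<in>C. flip Z ` E)) \<le> 2 ^ n / n"
    using exists_bad_cover[OF n, of U] by (auto simp: U_def)
  \<comment> \<open>The threshold \<open>n\<^sup>2\<close> makes the recorded cubes so few that
    about \<open>2 * n\<close> bits for each are affordable, while its logarithm stays of order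
    \<open>log 2 n\<close>.\<close>
  obtain J where J: "J \<subseteq> good" "n\<^sup>2 * card J \<le> card (\<Union>(cube ` J))"
      "\<forall>Z\<in>good. card (cube Z - \<Union>(cube ` J)) < n\<^sup>2"
    using greedy_packing[of good cube "n\<^sup>2"] n by auto
  define W where "W = {X \<in> K. n \<le> 4 * card (rich t X)} - \<Union>(cube ` J)"
  define I where "I = S \<union> (U - (\<Union>Z\<in>C. flip Z ` E)) \<union> W"
  have KE: "K \<subseteq> Pow E" by (auto simp: K_def V_def)
  have IK: "I \<subseteq> K" by (auto simp: I_def S_def U_def W_def)
  have finJ: "finite J" by (rule finite_subset[OF J(1)]) simp
  have cS: "real n * card S \<le> 2 * t * 2 ^ n"
    using lg by (intro card_small_neighbourhoods E) (auto simp: S_def t_def)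
  have cW: "real n * card W \<le> 32 * log 2 n * 2 ^ n"
  proof (rule card_rich_leftover_le[OF n _ t_def])
    fix Z assume Z: "Z \<in> good"
    have "card (W \<inter> cube Z) \<le> card (cube Z - \<Union>(cube ` J))"
      by (intro card_mono) (auto simp: W_def)
    then show "card (W \<inter> cube Z) < n\<^sup>2" using J(3) Z by fastforce
  qed (auto simp: W_def)
  have "card I \<le> card S + card (U - (\<Union>Z\<in>C. flip Z ` E)) + card W"
    unfolding I_def by (meson add_le_mono card_Un_le le_refl order_trans)
  then have "real (card I) \<le> real (card S) + real (card (U - (\<Union>Z\<in>C. flip Z ` E))) + real (card W)" by linarith
  also have "\<dots> \<le> 2 * t * 2 ^ n / n + 2 ^ n / n + 32 * log 2 n * 2 ^ n / n"
    using cS cW C(3) n0 by (intro add_mono) (auto simp: field_simps)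
  also have "\<dots> = (96 * log 2 n + 1) * (2 ^ n / n)" by (simp add: t_def add_divide_distrib algebra_simps)
  also have "\<dots> \<le> (100 * log 2 n) * (2 ^ n / n)" using lg by (intro mult_right_mono) auto
  finally have cI: "card I \<le> 100 * 2 ^ n / n * log 2 n" by (simp add: mult_ac)
  have "9 * 2 ^ n / n * log 2 n \<le> 100 * 2 ^ n / n * log 2 n"
    using lg by (intro mult_right_mono divide_right_mono) auto
  then have cC: "card C \<le> 100 * 2 ^ n / n * log 2 n" using C(2) by linarith
  have "\<Union>(cube ` J) \<subseteq> V b" by (auto simp: cube_def)
  then have "real (card (\<Union>(cube ` J))) \<le> 2 ^ n / 2" by (rule card_le_V[OF E])
  moreover have "real (n\<^sup>2 * card J) \<le> real (card (\<Union>(cube ` J)))" using J(2) by (simp only: of_nat_le_iff)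
  ultimately have "real n ^ 2 * card J \<le> 2 ^ n" by simp
  then have "card J \<le> 2 ^ n / n\<^sup>2" using n0 by (simp add: field_simps)
  then have cG: "card (key ` J) \<le> 2 ^ n / n\<^sup>2" using card_image_le[OF finJ, of key] by linarith
  \<comment> \<open>A key ignores parity, which the intersection with \<open>V b\<close>
    restores.\<close>
  have cubes: "V b \<inter> {X. \<exists>(H, R)\<in>key ` J. X - H = R} = \<Union>(cube ` J)"
    by (auto simp: key_def cube_def)
  have "K = V b \<inter> (I \<union> (\<Union>Z\<in>C. flip Z ` E) \<union> {X. \<exists>(H, R)\<in>key ` J. X - H = R})"
  proof
    show "V b \<inter> (I \<union> (\<Union>Z\<in>C. flip Z ` E) \<union> {X. \<exists>(H, R)\<in>key ` J. X - H = R}) \<subseteq> K"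
      using IK C(1) flip_bad_in_K cube_subset_K J(1) unfolding Int_Un_distrib cubes by blast
  next
    have "X \<in> I \<union> (\<Union>Z\<in>C. flip Z ` E) \<union> \<Union>(cube ` J)" if X: "X \<in> K" for X
    proof -
      define P2 where "P2 = {e \<in> E. real (card (A (flip X e))) \<le> t}"
      define P3 where "P3 = {e \<in> E - L X. card (A (flip X e)) \<le> 2 * card (L X)}"
      \<comment> \<open>One of the four sets has at least \<open>n / 4\<close> elements:
        \<open>L X\<close> or \<open>P3\<close> puts \<open>X\<close> into \<open>U\<close>,
        \<open>P2\<close> into \<open>S\<close>, and \<open>rich t X\<close> into \<open>W\<close>
        or a recorded cube.\<close>
      have Un: "L X \<union> P2 \<union> P3 \<union> rich t X = E" using L_subset by (auto simp: P2_def P3_def rich_def)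
      have "card (L X \<union> P2 \<union> P3 \<union> rich t X) \<le> card (L X) + card P2 + card P3 + card (rich t X)"
        using card_Un_le[of "L X \<union> P2 \<union> P3" "rich t X"] card_Un_le[of "L X \<union> P2" P3]
          card_Un_le[of "L X" P2] by linarith
      then have "n \<le> 4 * card (L X) \<or> n \<le> 4 * card P2 \<or> n \<le> 4 * card P3 \<or> n \<le> 4 * card (rich t X)"
        unfolding Un by linarith
      then show ?thesis using X unfolding P2_def P3_def I_def S_def U_def W_def by blast
    qed
    then show "K \<subseteq> V b \<inter> (I \<union> (\<Union>Z\<in>C. flip Z ` E) \<union> {X. \<exists>(H, R)\<in>key ` J. X - H = R})"
      using K_V unfolding Int_Un_distrib cubes by blast
  qed
  note K_eq = this
  have F_eq: "F = V b - K" using F_subset F_parity by (auto simp: K_def V_def)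
  have Diff_Int_self: "V b - V b \<inter> D = V b - D" for D by blast
  have "F = V b - (I \<union> (\<Union>Z\<in>C. flip Z ` E) \<union> {X. \<exists>(H, R)\<in>key ` J. X - H = R})"
    by (subst F_eq, subst K_eq, rule Diff_Int_self)
  moreover have "I \<subseteq> Pow E" "C \<subseteq> Pow E" "key ` J \<subseteq> Pow E \<times> Pow E"
    using IK KE C(1) J(1) subsetD[OF A_subset] by (auto simp: bad_def good_def V_def key_def)
  ultimately show ?thesis unfolding V_def
    by (intro exI[of _ I] exI[of _ C] exI[of _ "key ` J"] conjI cI cC cG)
qed

end

lemma even_dm_if_even_delta_matroid:
  assumes "even_delta_matroid E F"
  obtains b where "even_dm E F b"
proof -
  obtain X where X: "X \<in> F" using assms by (auto simp: even_delta_matroid_def delta_matroid_def)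
  have "even_dm E F (even (card X))"
  proof
    show "finite E" "\<And>Y. Y \<in> F \<Longrightarrow> Y \<subseteq> E"
      using assms by (simp_all add: even_delta_matroid_def delta_matroid_def)
    show "even (card Y) = even (card X)" if "Y \<in> F" for Y
      using assms X that unfolding even_delta_matroid_def by metis
    show "\<exists>f\<in>sdiff Y Z. sdiff Y {e, f} \<in> F" if "Y \<in> F" "Z \<in> F" "e \<in> sdiff Y Z" for Y Z e
      using assms that by (simp add: even_delta_matroid_def delta_matroid_def)
  qed
  then show ?thesis by (rule that)
qed

section \<open>The upper bound\<close>

text \<open>Counts descriptions: a parity bit, two families of at most \<open>m\<close> subsets, and
  at most \<open>m'\<close> pairs. The two families dominate, costing \<open>2 * m * \<mu>\<close>
  to leading order.\<close>

lemma num_even_dm_upper: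
  assumes n: "n \<ge> 2"
  shows "log 2 (num_even_dm n) \<le> 209 * (log 2 n)\<^sup>2 * (2 ^ n / n)"
proof -
  let ?E = "{1..n}"
  define \<mu> where "\<mu> = log 2 n"
  define q where "q = 2 ^ n / real n"
  define m where "m = 100 * 2 ^ n / n * \<mu>"
  define m' where "m' = 2 ^ n / (real n)\<^sup>2"
  define P where "P = {S. S \<subseteq> Pow ?E \<and> card S \<le> m}"
  define G where "G = {S. S \<subseteq> Pow ?E \<times> Pow ?E \<and> card S \<le> m'}"
  define dec where "dec = (\<lambda>(b, I, C, G :: (nat set \<times> nat set) set).
    {X. X \<subseteq> ?E \<and> even (card X) = b} - (I \<union> (\<Union>Z\<in>C. flip Z ` ?E) \<union> {X. \<exists>(H, R)\<in>G. X - H = R}))"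
  have fin: "finite P" "finite G" by (auto simp: P_def G_def)
  have n1: "real n \<ge> 1" using n by simp
  have \<mu>1: "\<mu> \<ge> 1" using n by (simp add: \<mu>_def le_log_iff)
  have q1: "q \<ge> 1" using n less_exp[of n] by (simp add: q_def field_simps less_imp_le)
  have sub: "{\<F>. \<F> \<subseteq> Pow ?E \<and> even_delta_matroid ?E \<F>} \<subseteq> dec ` (UNIV \<times> P \<times> P \<times> G)"
  proof
    fix \<F> assume "\<F> \<in> {\<F>. \<F> \<subseteq> Pow ?E \<and> even_delta_matroid ?E \<F>}"
    then obtain b where "even_dm ?E \<F> b" using even_dm_if_even_delta_matroid by blast
    then interpret even_dm ?E \<F> b .
    have c: "card ?E = n" by simp
    obtain I C H where "I \<subseteq> Pow ?E" "C \<subseteq> Pow ?E" "H \<subseteq> Pow ?E \<times> Pow ?E"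
      "card I \<le> m" "card C \<le> m" "card H \<le> m'"
      and eq: "\<F> = {X. X \<subseteq> ?E \<and> even (card X) = b} - (I \<union> (\<Union>Z\<in>C. flip Z ` ?E) \<union> {X. \<exists>(H, R)\<in>H. X - H = R})"
      using compressed_description[unfolded c, OF n] unfolding m_def m'_def \<mu>_def of_nat_power
      by (elim exE conjE)
    then have "(b, I, C, H) \<in> UNIV \<times> P \<times> P \<times> G" by (simp add: P_def G_def)
    moreover have "\<F> = dec (b, I, C, H)" unfolding dec_def prod.case by (rule eq)
    ultimately show "\<F> \<in> dec ` (UNIV \<times> P \<times> P \<times> G)" by blast
  qed
  have "num_even_dm n \<le> card (dec ` (UNIV \<times> P \<times> P \<times> G))"
    unfolding num_even_dm_def using fin by (intro card_mono[OF _ sub]) auto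
  also have "\<dots> \<le> card ((UNIV :: bool set) \<times> P \<times> P \<times> G)" using fin by (intro card_image_le) auto
  also have "\<dots> = 2 * (card P * (card P * card G))" by (simp add: card_cartesian_product)
  finally have "real (num_even_dm n) \<le> real (2 * (card P * (card P * card G)))" by (simp only: of_nat_le_iff)
  then have num: "real (num_even_dm n) \<le> 2 * (real (card P) * (real (card P) * real (card G)))" by simp
  \<comment> \<open>With \<open>y = n\<close> the exponential factor contributes only
    \<open>O(q)\<close> to the logarithm.\<close>
  have cP: "card P \<le> n powr m * exp q"
    using card_bounded_subsets_le[of "Pow ?E" n m] n1 by (simp add: P_def q_def card_Pow)
  \<comment> \<open>Here \<open>y\<close> is the number of all pairs, so the exponential factor is
    constant.\<close>
  have cG: "card G \<le> (4 ^ n) powr m' * exp 1"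
    using card_bounded_subsets_le[of "Pow ?E \<times> Pow ?E" "4 ^ n" m']
    by (simp add: G_def card_Pow card_cartesian_product power_mult_distrib[symmetric])
  have "2 * (real (card P) * (real (card P) * real (card G))) \<le> 2 * ((n powr m * exp q) * ((n powr m * exp q) * ((4 ^ n) powr m' * exp 1)))"
    by (intro mult_left_mono mult_mono cP cG) auto
  then have "log 2 (num_even_dm n) \<le> log 2 (2 * ((n powr m * exp q) * ((n powr m * exp q) * ((4 ^ n) powr m' * exp 1))))"
    using num num_even_dm_ge_2[of n] n by (subst log_le_cancel_iff) auto
  also have "\<dots> = 1 + 2 * (m * \<mu> + q * log 2 (exp 1)) + 2 * n * m' + log 2 (exp 1)"
  proof -
    have le: "log 2 (exp q) = q * log 2 (exp 1)" by (simp add: log_def)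
    have l4: "log 2 ((4::real) ^ n) = 2 * n"
      using log_pow_cancel[of "2::real" "2 * n"] by (simp add: power_mult)
    have lP: "log 2 (n powr m * exp q) = m * \<mu> + q * log 2 (exp 1)"
      using n by (subst log_mult) (auto simp: log_powr \<mu>_def le)
    have lG: "log 2 ((4 ^ n) powr m' * exp 1) = 2 * n * m' + log 2 (exp 1)"
      by (subst log_mult) (auto simp: log_powr l4)
    have "log 2 (2 * (x * (x * y))) = 1 + 2 * log 2 x + log 2 y" if "x > 0" "y > 0" for x y :: real
      using that by (simp add: log_mult)
    from this[of "n powr m * exp q" "(4 ^ n) powr m' * exp 1"] show ?thesis
      unfolding lP lG using n by simp
  qed
  also have "\<dots> \<le> 1 + 2 * (m * \<mu> + q * 2) + 2 * n * m' + 2"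
  proof -
    have "log 2 (exp 1) \<le> log 2 (2 ^ 2)" using exp_le by (intro log_mono) auto
    also have "log 2 ((2::real) ^ 2) = 2" using log_pow_cancel[of "2::real" 2] by simp
    finally have le2: "log 2 (exp 1) \<le> 2" .
    then have "2 * (m * \<mu> + q * log 2 (exp 1)) \<le> 2 * (m * \<mu> + q * 2)"
      using q1 by (intro mult_left_mono add_left_mono) auto
    then show ?thesis by (intro add_mono[OF _ le2] add_right_mono add_left_mono)
  qed
  \<comment> \<open>The linear term collects \<open>4 * q\<close> from the two families and
    \<open>2 * n * m' = 2 * q\<close> from the pairs.\<close>
  also have "\<dots> = 3 + 200 * \<mu>\<^sup>2 * q + 6 * q"
    using n1 by (simp add: m_def m'_def q_def power2_eq_square field_simps)
  also have "\<dots> \<le> 200 * \<mu>\<^sup>2 * q + 9 * (\<mu>\<^sup>2 * q)"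
  proof -
    have "1 * q \<le> \<mu>\<^sup>2 * q" using \<mu>1 q1 by (intro mult_right_mono) auto
    then show ?thesis using q1 by linarith
  qed
  finally show ?thesis by (simp add: \<mu>_def q_def mult_ac)
qed

theorem theorem3:
  shows "(\<forall>n::nat. n \<ge> 1 \<longrightarrow>
            log 2 (log 2 (real (num_even_dm n))) \<ge> real n - log 2 (real n) - 1)
       \<and> (\<exists>C::real. \<forall>\<^sub>F n in at_top.
            log 2 (log 2 (real (num_even_dm n)))
              \<le> real n - log 2 (real n) + C * log 2 (log 2 (real n)))"
proof (intro conjI allI impI exI)
  fix n :: nat assume n: "n \<ge> 1"
  have "real n - log 2 (real n) - 1 = log 2 (2 ^ n / (2 * n))"
    using n by (simp add: log_divide log_mult log_nat_power)
  also have "\<dots> \<le> log 2 (log 2 (real (num_even_dm n)))"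
    using num_even_dm_lower[OF n] n by (intro log_mono) auto
  finally show "real n - log 2 (real n) - 1 \<le> log 2 (log 2 (real (num_even_dm n)))" .
next
  show "\<forall>\<^sub>F n in at_top. log 2 (log 2 (real (num_even_dm n)))
              \<le> real n - log 2 (real n) + 3 * log 2 (log 2 (real n))"
  proof (rule eventually_at_top_linorderI)
    \<comment> \<open>From here on \<open>log 2 (log 2 n)\<close> is at least 8. The constant 3
      consists of 2 for the squared logarithm and 1 to absorb that 8.\<close>
    fix n :: nat assume n: "2 ^ 256 \<le> n"
    have log_pow2: "log 2 ((2::real) ^ k) = k" for k by (rule log_pow_cancel) auto
    have "(2::nat) ^ 1 \<le> 2 ^ 256" by (rule power_increasing) auto
    then have n2: "n \<ge> 2" using n by simp
    define \<mu> where "\<mu> = log 2 n"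
    have "real (2 ^ 256) \<le> real n" using n by (simp only: of_nat_le_iff)
    then have "log 2 (2 ^ 256) \<le> \<mu>" unfolding \<mu>_def by (intro log_mono) auto
    then have \<mu>: "\<mu> \<ge> 256" unfolding log_pow2 by simp
    then have "log 2 (2 ^ 8) \<le> log 2 \<mu>" by (intro log_mono) auto
    then have l8: "8 \<le> log 2 \<mu>" unfolding log_pow2 by simp
    have pos: "log 2 (num_even_dm n) > 0"
      using num_even_dm_ge_2[of n] n2 by (simp add: zero_less_log_cancel_iff)
    \<comment> \<open>Rounding 209 up to \<open>2 ^ 8\<close> makes its logarithm exact.\<close>
    have "209 * \<mu>\<^sup>2 * (2 ^ n / n) \<le> 2 ^ 8 * \<mu>\<^sup>2 * (2 ^ n / n)"
      by (rule mult_right_mono, rule mult_right_mono) auto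
    with num_even_dm_upper[OF n2] have "log 2 (num_even_dm n) \<le> 2 ^ 8 * \<mu>\<^sup>2 * (2 ^ n / n)"
      unfolding \<mu>_def by (rule order_trans)
    then have "log 2 (log 2 (num_even_dm n)) \<le> log 2 (2 ^ 8 * \<mu>\<^sup>2 * (2 ^ n / n))"
      using pos by (intro log_mono) auto
    also have "\<dots> = 8 + 2 * log 2 \<mu> + (n - log 2 n)"
    proof -
      have "log 2 (2 ^ 8 * \<mu>\<^sup>2 * (2 ^ n / n)) = log 2 (2 ^ 8) + log 2 (\<mu>\<^sup>2) + log 2 (2 ^ n / n)"
        using \<mu> n2 by (simp only: log_mult) (auto simp: log_mult)
      also have "log 2 (2 ^ n / n) = n - log 2 n" using n2 by (simp add: log_divide log_nat_power)
      also have "log 2 (\<mu>\<^sup>2) = 2 * log 2 \<mu>" using \<mu> by (simp add: log_nat_power)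
      finally show ?thesis unfolding log_pow2 by simp
    qed
    also have "\<dots> \<le> real n - log 2 n + 3 * log 2 \<mu>" using l8 by linarith
    finally show "log 2 (log 2 (real (num_even_dm n))) \<le> real n - log 2 (real n) + 3 * log 2 (log 2 (real n))"
      by (simp add: \<mu>_def)
  qed
qed

end
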